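(* There exist absolute constants $c, C, C_0>0$ such that for every integer $s\ge 1$ there is $r_0=r_0(s)$ with the following property: for all integers $r\ge r_0$ and $n\ge C_0\, r$, $$c\cdot \frac{2^{s}}{r}\cdot n\;\le\; f(n,r,s)\;\le\; C\cdot \frac{2^{s}}{r}\cdot n .$$ (In the paper's notation: for $s\ge 1$, $r$ large enough and $n\ge \Omega(r)$, $f(n,r,s)=\frac{\Theta(2^s)}{r}\cdot n$.)
   Context: An $r$-edge colouring of the complete graph $K_n$ assigns to each edge one of $r$ colours. $f(n,r,s)$ denotes the largest integer $m$ such that in every $r$-edge colouring of $K_n$ there exist a set $S$ of at most $s$ colours and a connected subgraph of $K_n$ on at least $m$ vertices all of whose edges have colours in $S$ (i.e. the maximum number of vertices one can guarantee to connect using edges of up to $s$ colours). *)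

theory Defs
  imports Complex_Main "Graph_Theory.Graph_Theory"
begin

text \<open>As in the Graph_Theory entry of the AFP, an undirected graph is a symmetric digraph without
  loops: the edge \<open>{u, v}\<close> is the pair of arcs \<open>(u, v)\<close>, \<open>(v, u)\<close>.\<close>

definition complete_graph :: "nat \<Rightarrow> nat pair_pre_digraph" where
  "complete_graph n =
     \<lparr>pverts = {0..<n}, parcs = {(u, v). u \<in> {0..<n} \<and> v \<in> {0..<n} \<and> u \<noteq> v}\<rparr>"

text \<open>A colouring acts on the unordered pair \<open>{u, v}\<close>, so both arcs of an edge get the same colour.
  Its values on other sets of naturals are irrelevant. The colours are \<open>0, \<dots>, r - 1\<close>, and they
  need not all be used.\<close>

definition edge_colouring :: "nat \<Rightarrow> nat \<Rightarrow> (nat set \<Rightarrow> nat) \<Rightarrow> bool" where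
  "edge_colouring n r \<chi> \<longleftrightarrow> (\<forall>(u, v) \<in> parcs (complete_graph n). \<chi> {u, v} \<in> {0..<r})"

text \<open>The constant \<open>connected\<close> is qualified because Complex_Main has a topological notion of the
  same name. The subgraph is not required to be induced, nor to use every colour of \<open>S\<close>.\<close>

definition connects :: "nat \<Rightarrow> (nat set \<Rightarrow> nat) \<Rightarrow> nat set \<Rightarrow> nat \<Rightarrow> bool" where
  "connects n \<chi> S m \<longleftrightarrow>
     (\<exists>H :: nat pair_pre_digraph.
        subgraph (with_proj H) (with_proj (complete_graph n)) \<and>
        symmetric (with_proj H) \<and>
        Digraph_Component.connected (with_proj H) \<and>
        m \<le> card (pverts H) \<and>
        (\<forall>(u, v) \<in> parcs H. \<chi> {u, v} \<in> S))"

definition guaranteed :: "nat \<Rightarrow> nat \<Rightarrow> nat \<Rightarrow> nat \<Rightarrow> bool" where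
  "guaranteed n r s m \<longleftrightarrow>
     (\<forall>\<chi>. edge_colouring n r \<chi> \<longrightarrow> (\<exists>S \<subseteq> {0..<r}. card S \<le> s \<and> connects n \<chi> S m))"

text \<open>The number \<open>f(n, r, s)\<close>. For \<open>n, r \<ge> 1\<close> the maximum is over a finite non-empty set,
  see \<open>le_conn_number_iff\<close> below.\<close>

definition conn_number :: "nat \<Rightarrow> nat \<Rightarrow> nat \<Rightarrow> nat" where
  "conn_number n r s = Max {m. guaranteed n r s m}"

lemma complete_graph_complete: "complete_digraph n (with_proj (complete_graph n))"
  by (auto simp: complete_digraph_pair_def complete_graph_def)

lemma guaranteed_le:
  assumes "r \<ge> 1" "guaranteed n r s m"
  shows "m \<le> n"
proof -
  have "edge_colouring n r (\<lambda>_. 0)"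
    using assms(1) by (auto simp: edge_colouring_def)
  then obtain H :: "nat pair_pre_digraph" where
    "subgraph (with_proj H) (with_proj (complete_graph n))" and m: "m \<le> card (pverts H)"
    using assms(2) unfolding guaranteed_def connects_def by blast
  then have "pverts H \<subseteq> {0..<n}"
    by (auto simp: subgraph_def complete_graph_def)
  then have "card (pverts H) \<le> n"
    using card_mono[of "{0..<n}" "pverts H"] by simp
  with m show ?thesis by simp
qed

lemma guaranteed_mono:
  assumes "guaranteed n r s m" "m' \<le> m"
  shows "guaranteed n r s m'"
proof -
  have "connects n \<chi> S m'" if "connects n \<chi> S m" for \<chi> S
  proof -
    from that obtain H :: "nat pair_pre_digraph" where
      "subgraph (with_proj H) (with_proj (complete_graph n)) \<and> symmetric (with_proj H) \<and>
       Digraph_Component.connected (with_proj H)"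
      and "m \<le> card (pverts H)" and "\<forall>(u, v) \<in> parcs H. \<chi> {u, v} \<in> S"
      unfolding connects_def by (elim exE conjE) simp
    with assms(2) show ?thesis
      unfolding connects_def by (intro exI[of _ H]) simp
  qed
  with assms(1) show ?thesis
    unfolding guaranteed_def by meson
qed

lemma guaranteed_1:
  assumes "n \<ge> 1"
  shows "guaranteed n r s 1"
proof -
  let ?H = "\<lparr>pverts = {0}, parcs = {}\<rparr> :: nat pair_pre_digraph"
  have "wf_digraph (with_proj (complete_graph n))" "wf_digraph (with_proj ?H)"
    by (auto simp: wf_digraph_def complete_graph_def)
  then have "subgraph (with_proj ?H) (with_proj (complete_graph n))"
    using assms by (auto simp: subgraph_def complete_graph_def)
  moreover have "symmetric (with_proj ?H)"
    by (auto simp: symmetric_def sym_def)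
  moreover have "Digraph_Component.connected (with_proj ?H)"
    by (auto simp: Digraph_Component.connected_def strongly_connected_def mk_symmetric_def
        reachable_def)
  ultimately have "connects n \<chi> {} 1" for \<chi>
    unfolding connects_def by (intro exI[of _ ?H]) auto
  then show ?thesis
    unfolding guaranteed_def by (intro allI impI exI[of _ "{}"]) simp
qed

lemma le_conn_number_iff:
  assumes "n \<ge> 1" "r \<ge> 1"
  shows "m \<le> conn_number n r s \<longleftrightarrow> guaranteed n r s m"
proof -
  let ?M = "{m. guaranteed n r s m}"
  have fin: "finite ?M"
    by (rule finite_subset[of _ "{..n}"]) (use guaranteed_le[OF assms(2)] in auto)
  have "?M \<noteq> {}" using guaranteed_1[OF assms(1)] by auto
  then have "guaranteed n r s (conn_number n r s)"
    using Max_in[OF fin] by (simp add: conn_number_def)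
  then show ?thesis
    using Max_ge[OF fin, of m] guaranteed_mono[of n r s "conn_number n r s" m]
    unfolding conn_number_def by blast
qed

end

theory Submission
  imports Defs
begin

text \<open>For the lower bound, suppose that \<open>s\<close> colours never connect more than \<open>2 ^ s n / r\<close> vertices.
  Build \<open>S\<close> one colour at a time, together with a probability weight \<open>\<nu>\<close> on the vertices with
  \<open>\<nu> \<le> K / n\<close>, where \<open>K\<close> depends only on \<open>s\<close>. Two independent \<open>\<nu>\<close>-random vertices \<open>u\<close>, \<open>w\<close> lie in
  different \<open>S\<close>-components except with probability \<open>O(1 / r)\<close>, and adding the colour \<open>i\<close> of the edge
  \<open>{u, w}\<close> merges their components. As \<open>1 / (a + b) \<le> (1 / a + 1 / b) / 4\<close>, this halves the expected
  reciprocal of the component size of \<open>u\<close>. The next weight is the law of \<open>u\<close> given \<open>i\<close>, for a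
  suitable value of \<open>i\<close>. It is again spread out if that value is not too improbable: a vertex has
  \<open>O(n / r)\<close> neighbours in colour \<open>i\<close>, and almost all of the mass lies on colours of probability at
  least \<open>\<eta> / r\<close>. Since the graph is complete, the new weight can be used in the same way. The loss
  per step is a factor \<open>1 + 1 / s\<close>, hence bounded in total.\<close>

section \<open>Components in a set of colours\<close>

definition colour_arcs :: "nat \<Rightarrow> (nat set \<Rightarrow> nat) \<Rightarrow> nat set \<Rightarrow> nat rel" where
  "colour_arcs n \<chi> S = {(u, w). u < n \<and> w < n \<and> u \<noteq> w \<and> \<chi> {u, w} \<in> S}"

text \<open>An equivalence class, as the arcs are symmetric. For \<open>u \<ge> n\<close> it is the
  singleton of \<open>u\<close>.\<close>

definition component :: "nat \<Rightarrow> (nat set \<Rightarrow> nat) \<Rightarrow> nat set \<Rightarrow> nat \<Rightarrow> nat set" where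
  "component n \<chi> S u = {w. (u, w) \<in> (colour_arcs n \<chi> S)\<^sup>*}"

lemma sym_colour_arcs: "sym (colour_arcs n \<chi> S)"
  by (auto simp: sym_def colour_arcs_def insert_commute)

lemma self_in_component [simp]: "u \<in> component n \<chi> S u"
  by (simp add: component_def)

lemma component_subset:
  assumes "u < n"
  shows "component n \<chi> S u \<subseteq> {..<n}"
proof
  fix w assume "w \<in> component n \<chi> S u"
  then have "(u, w) \<in> (colour_arcs n \<chi> S)\<^sup>*" by (simp add: component_def)
  then show "w \<in> {..<n}"
    by (induction rule: rtrancl_induct) (use assms in \<open>auto simp: colour_arcs_def\<close>)
qed

lemma finite_component: "u < n \<Longrightarrow> finite (component n \<chi> S u)"
  by (rule finite_subset[OF component_subset]) auto

lemma component_mono: "S \<subseteq> T \<Longrightarrow> component n \<chi> S u \<subseteq> component n \<chi> T u"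
proof -
  assume "S \<subseteq> T"
  then have "colour_arcs n \<chi> S \<subseteq> colour_arcs n \<chi> T" by (auto simp: colour_arcs_def)
  then show ?thesis unfolding component_def using rtrancl_mono by blast
qed

lemma component_eq:
  assumes "w \<in> component n \<chi> S u"
  shows "component n \<chi> S w = component n \<chi> S u"
proof -
  have uw: "(u, w) \<in> (colour_arcs n \<chi> S)\<^sup>*" using assms by (simp add: component_def)
  then have "(w, u) \<in> (colour_arcs n \<chi> S)\<^sup>*"
    using sym_rtrancl[OF sym_colour_arcs] by (meson symE)
  with uw show ?thesis
    unfolding component_def by (auto intro: rtrancl_trans)
qed

lemma component_arc:
  assumes "u < n" "w < n" "u \<noteq> w" "\<chi> {u, w} \<in> S"
  shows "w \<in> component n \<chi> S u"
  using assms by (auto simp: component_def colour_arcs_def intro!: r_into_rtrancl)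

lemma card_component_pos: "u < n \<Longrightarrow> card (component n \<chi> S u) > 0"
  unfolding card_gt_0_iff using finite_component self_in_component by (metis empty_iff)

text \<open>The edge \<open>{u, w}\<close> carries the added colour, so it joins two disjoint
  components into one.\<close>

lemma card_component_insert:
  assumes "u < n" "w < n" "w \<notin> component n \<chi> S u"
  shows "card (component n \<chi> S u) + card (component n \<chi> S w)
    \<le> card (component n \<chi> (insert (\<chi> {u, w}) S) u)"
proof -
  let ?T = "insert (\<chi> {u, w}) S"
  have "component n \<chi> S u \<inter> component n \<chi> S w = {}"
    using assms(3) component_eq self_in_component by blast
  then have "card (component n \<chi> S u) + card (component n \<chi> S w)
    = card (component n \<chi> S u \<union> component n \<chi> S w)"
    using finite_component assms by (simp add: card_Un_disjoint)
  also have "\<dots> \<le> card (component n \<chi> ?T u)"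
  proof (rule card_mono)
    have "w \<in> component n \<chi> ?T u"
      using component_arc[of u n w \<chi> ?T] assms by (metis insertI1 self_in_component)
    then have "component n \<chi> ?T w = component n \<chi> ?T u" by (rule component_eq)
    then show "component n \<chi> S u \<union> component n \<chi> S w \<subseteq> component n \<chi> ?T u"
      using component_mono[of S ?T n \<chi>] by blast
  qed (use assms finite_component in auto)
  finally show ?thesis .
qed

section \<open>From connected subgraphs to components\<close>

text \<open>A connected subgraph lies in the component of any of its vertices, and a component with
  all its arcs is itself such a subgraph.\<close>

lemma connects_iff_component:
  "connects n \<chi> S m \<longleftrightarrow> (\<exists>u<n. m \<le> card (component n \<chi> S u))"
proof
  assume "connects n \<chi> S m"
  then obtain H :: "nat pair_pre_digraph" where
    sub: "subgraph (with_proj H) (with_proj (complete_graph n))"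
    and sym: "symmetric (with_proj H)"
    and conn: "Digraph_Component.connected (with_proj H)"
    and m: "m \<le> card (pverts H)"
    and col: "\<forall>(u, v) \<in> parcs H. \<chi> {u, v} \<in> S"
    unfolding connects_def by blast
  have V: "pverts H \<subseteq> {0..<n}" and E: "parcs H \<subseteq> parcs (complete_graph n)"
    using sub by (auto simp: subgraph_def complete_graph_def)
  have *: "parcs H \<subseteq> colour_arcs n \<chi> S"
    using E col by (auto simp: complete_graph_def colour_arcs_def)
  \<comment> \<open>\<open>connected\<close> means reachability in the symmetric closure; the arcs
    it adds are reversals and stay in the symmetric relation \<open>colour_arcs\<close>.\<close>
  have eq: "parcs (mk_symmetric (with_proj H)) \<subseteq> colour_arcs n \<chi> S"
  proof
    fix e assume "e \<in> parcs (mk_symmetric (with_proj H))"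
    then obtain a where "a \<in> parcs H" "e = (fst a, snd a) \<or> e = (snd a, fst a)"
      by (auto simp: mk_symmetric_def)
    with * show "e \<in> colour_arcs n \<chi> S"
      using symD[OF sym_colour_arcs, of "fst a" "snd a" n \<chi> S] by fastforce
  qed
  obtain u where u: "u \<in> pverts H"
    using conn by (auto simp: Digraph_Component.connected_def strongly_connected_def mk_symmetric_def)
  have "pverts H \<subseteq> component n \<chi> S u"
  proof
    fix v assume "v \<in> pverts H"
    then have "u \<rightarrow>\<^sup>*\<^bsub>with_proj (mk_symmetric (with_proj H))\<^esub> v"
      using conn u
      by (auto simp: Digraph_Component.connected_def strongly_connected_def mk_symmetric_def)
    then have "(u, v) \<in> (parcs (mk_symmetric (with_proj H)))\<^sup>*"
      using reachable_rtranclI[where G = "with_proj (mk_symmetric (with_proj H))"] by simp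
    then show "v \<in> component n \<chi> S u"
      unfolding component_def using rtrancl_mono[OF eq] by auto
  qed
  then have "m \<le> card (component n \<chi> S u)"
    using m card_mono[OF finite_component] u V by (meson atLeastLessThan_iff le_trans subsetD)
  moreover have "u < n" using u V by auto
  ultimately show "\<exists>u<n. m \<le> card (component n \<chi> S u)" by blast
next
  assume "\<exists>u<n. m \<le> card (component n \<chi> S u)"
  then obtain u where u: "u < n" and m: "m \<le> card (component n \<chi> S u)" by blast
  let ?C = "component n \<chi> S u"
  define H :: "nat pair_pre_digraph"
    where "H = \<lparr>pverts = ?C, parcs = {(v, w) \<in> colour_arcs n \<chi> S. v \<in> ?C \<and> w \<in> ?C}\<rparr>"
  have wfs: "wf_digraph (with_proj (complete_graph n))" "wf_digraph (with_proj H)"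
    by (auto simp: wf_digraph_def complete_graph_def H_def)
  then have sub: "subgraph (with_proj H) (with_proj (complete_graph n))"
    using component_subset[OF u, of \<chi> S]
    by (auto simp: subgraph_def complete_graph_def H_def colour_arcs_def)
  have sym: "symmetric (with_proj H)"
    using sym_colour_arcs[of n \<chi> S] by (auto simp: symmetric_def sym_def H_def)
  interpret wf_digraph "with_proj H" by (rule wfs)
  have reach: "u \<rightarrow>\<^sup>*\<^bsub>with_proj H\<^esub> w" if "w \<in> ?C" for w
  proof -
    have "(u, w) \<in> (colour_arcs n \<chi> S)\<^sup>*" using that by (simp add: component_def)
    then show ?thesis
    proof (induction rule: rtrancl_induct)
      case base
      show ?case by (rule reachable_refl) (simp add: H_def)
    next
      case (step y z)
      then have "y \<in> ?C" "z \<in> ?C" unfolding component_def by auto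
      with step.hyps have "y \<rightarrow>\<^bsub>with_proj H\<^esub> z" by (simp add: H_def)
      with step.IH show ?case by (rule reachable_adj_trans)
    qed
  qed
  have "strongly_connected (with_proj (mk_symmetric (with_proj H)))"
  proof (rule strongly_connectedI)
    show "verts (with_proj (mk_symmetric (with_proj H))) \<noteq> {}"
    proof -
      have "u \<in> verts (with_proj (mk_symmetric (with_proj H)))"
        by (simp add: mk_symmetric_def H_def)
      then show ?thesis by blast
    qed
  next
    fix v w
    assume "v \<in> verts (with_proj (mk_symmetric (with_proj H)))"
      "w \<in> verts (with_proj (mk_symmetric (with_proj H)))"
    then have "v \<in> ?C" "w \<in> ?C" by (auto simp: mk_symmetric_def H_def)
    \<comment> \<open>The walk goes through \<open>u\<close>: the one from \<open>u\<close> to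
      \<open>v\<close> is reversed by symmetry of \<open>H\<close>.\<close>
    then have "v \<rightarrow>\<^sup>*\<^bsub>with_proj H\<^esub> w"
      using reachable_trans[OF symmetric_reachable[OF sym reach] reach] by simp
    then show "v \<rightarrow>\<^sup>*\<^bsub>with_proj (mk_symmetric (with_proj H))\<^esub> w"
      by (rule reachable_mk_symmetricI)
  qed
  then have "Digraph_Component.connected (with_proj H)"
    by (simp add: Digraph_Component.connected_def)
  with sub sym m show "connects n \<chi> S m"
    unfolding connects_def by (intro exI[of _ H]) (auto simp: H_def colour_arcs_def)
qed

lemma guaranteed_iff_component:
  "guaranteed n r s m \<longleftrightarrow>
    (\<forall>\<chi>. edge_colouring n r \<chi> \<longrightarrow>
      (\<exists>S \<subseteq> {0..<r}. card S \<le> s \<and> (\<exists>u<n. m \<le> card (component n \<chi> S u))))"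
  by (simp add: guaranteed_def connects_iff_component)

lemma edge_colouringD:
  "edge_colouring n r \<chi> \<Longrightarrow> u < n \<Longrightarrow> w < n \<Longrightarrow> u \<noteq> w \<Longrightarrow> \<chi> {u, w} < r"
  by (fastforce simp: edge_colouring_def complete_graph_def)

section \<open>The upper bound\<close>

text \<open>\<open>T\<close> is the span of \<open>S\<close> over the field with two elements; each
  new generator at most doubles it.\<close>

lemma exists_xor_closed:
  fixes S :: "nat set"
  assumes "finite S"
  shows "\<exists>T. finite T \<and> card T \<le> 2 ^ card S \<and> 0 \<in> T
    \<and> (\<forall>s\<in>S. \<forall>t\<in>T. Bit_Operations.xor s t \<in> T)"
  using assms
proof (induction S)
  case empty
  show ?case by (intro exI[of _ "{0}"]) simp
next
  case (insert x S)
  then obtain T where T: "finite T" "card T \<le> 2 ^ card S" "0 \<in> T"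
    and cl: "\<forall>s\<in>S. \<forall>t\<in>T. Bit_Operations.xor s t \<in> T" by blast
  let ?U = "T \<union> Bit_Operations.xor x ` T"
  have "card ?U \<le> card T + card T"
    using card_Un_le[of T "Bit_Operations.xor x ` T"] card_image_le[OF T(1), of "Bit_Operations.xor x"]
    by linarith
  then have "card ?U \<le> 2 ^ card (insert x S)" using T(2) insert.hyps by simp
  moreover have "Bit_Operations.xor s t \<in> ?U" if s: "s \<in> insert x S" and t: "t \<in> ?U" for s t
  proof (cases "s = x")
    case True
    with t show ?thesis
      by (auto simp: xor.assoc[symmetric])
  next
    case False
    with s have "s \<in> S" by simp
    from t consider "t \<in> T" | t' where "t = Bit_Operations.xor x t'" "t' \<in> T" by blast
    then show ?thesis
    proof cases
      case 2
      then have "Bit_Operations.xor s t = Bit_Operations.xor x (Bit_Operations.xor s t')"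
        by (simp add: xor.left_commute)
      with 2 \<open>s \<in> S\<close> cl show ?thesis by simp
    qed (use \<open>s \<in> S\<close> cl in blast)
  qed
  ultimately show ?case using T by (intro exI[of _ ?U]) auto
qed

lemma card_residue_class_le:
  assumes "q > (0::nat)"
  shows "card {v. v < n \<and> v mod q = a} \<le> n div q + 1"
proof -
  have "inj_on (\<lambda>v. v div q) {v. v < n \<and> v mod q = a}"
    by (auto simp: inj_on_def) (metis div_mult_mod_eq)
  then have "card {v. v < n \<and> v mod q = a} = card ((\<lambda>v. v div q) ` {v. v < n \<and> v mod q = a})"
    by (simp add: card_image)
  also have "\<dots> \<le> card {..n div q}"
    by (rule card_mono) (auto simp: div_le_mono)
  finally show ?thesis by simp
qed

text \<open>The extremal colouring: blow up the complete graph on the group of bit strings of length \<open>k\<close>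
  and colour an edge by the difference of its ends, so that \<open>s\<close> colours only connect a coset of a
  subgroup of order at most \<open>2 ^ s\<close>.\<close>

definition xor_colouring :: "nat \<Rightarrow> nat set \<Rightarrow> nat" where
  "xor_colouring k e = take_bit k (Bit_Operations.xor (Min e) (Max e))"

text \<open>\<open>Min\<close> and \<open>Max\<close> recover the two ends from the unordered pair;
  their order is irrelevant as xor commutes.\<close>

lemma xor_colouring_pair: "xor_colouring k {u, v} = take_bit k (Bit_Operations.xor u v)"
  by (cases "u \<le> v") (simp_all add: xor_colouring_def xor.commute)

text \<open>A vertex stands for its residue modulo \<open>2 ^ k\<close>. Each arc of a walk shifts
  the residue by an element of \<open>S\<close>, so the component meets at most
  \<open>card T\<close> residue classes.\<close>

lemma card_component_xor_colouring:
  assumes u: "u < n" and S: "finite S"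
  shows "card (component n (xor_colouring k) S u) \<le> 2 ^ card S * (n div 2 ^ k + 1)"
proof -
  obtain T where T: "finite T" "card T \<le> 2 ^ card S" "0 \<in> T"
    and cl: "\<forall>s\<in>S. \<forall>t\<in>T. Bit_Operations.xor s t \<in> T"
    using exists_xor_closed[OF S] by blast
  have in_T: "take_bit k (Bit_Operations.xor u v) \<in> T" if "v \<in> component n (xor_colouring k) S u" for v
  proof -
    have "(u, v) \<in> (colour_arcs n (xor_colouring k) S)\<^sup>*" using that by (simp add: component_def)
    then show ?thesis
    proof (induction rule: rtrancl_induct)
      case base
      show ?case using T by simp
    next
      case (step y z)
      have "take_bit k (Bit_Operations.xor y z) \<in> S"
        using step.hyps by (simp add: colour_arcs_def xor_colouring_pair)
      then have "Bit_Operations.xor (take_bit k (Bit_Operations.xor y z))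
          (take_bit k (Bit_Operations.xor u y)) \<in> T"
        using cl step.IH by blast
      \<comment> \<open>The differences telescope: \<open>y\<close> cancels against itself.\<close>
      also have "Bit_Operations.xor (take_bit k (Bit_Operations.xor y z))
          (take_bit k (Bit_Operations.xor u y))
        = take_bit k (Bit_Operations.xor (Bit_Operations.xor y y) (Bit_Operations.xor u z))"
        by (simp only: take_bit_xor xor.assoc xor.commute xor.left_commute)
      finally show ?case by simp
    qed
  qed
  have "component n (xor_colouring k) S u
    \<subseteq> (\<Union>t\<in>T. {v. v < n \<and> v mod 2 ^ k = Bit_Operations.xor (take_bit k u) t})"
  proof
    fix v assume v: "v \<in> component n (xor_colouring k) S u"
    have "v mod 2 ^ k = take_bit k v" by (simp add: take_bit_eq_mod)
    also have "\<dots> = Bit_Operations.xor (take_bit k u) (take_bit k (Bit_Operations.xor u v))"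
      by (simp add: take_bit_xor xor.assoc[symmetric])
    finally show "v \<in> (\<Union>t\<in>T. {v. v < n \<and> v mod 2 ^ k = Bit_Operations.xor (take_bit k u) t})"
      using in_T[OF v] component_subset[OF u] v by blast
  qed
  then have "card (component n (xor_colouring k) S u)
    \<le> card (\<Union>t\<in>T. {v. v < n \<and> v mod 2 ^ k = Bit_Operations.xor (take_bit k u) t})"
    by (intro card_mono) (use T in auto)
  also have "\<dots> \<le> (\<Sum>t\<in>T. card {v. v < n \<and> v mod 2 ^ k = Bit_Operations.xor (take_bit k u) t})"
    by (rule card_UN_le[OF T(1)])
  also have "\<dots> \<le> (\<Sum>t\<in>T. n div 2 ^ k + 1)"
    by (intro sum_mono card_residue_class_le) simp
  also have "\<dots> = card T * (n div 2 ^ k + 1)" by simp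
  also have "\<dots> \<le> 2 ^ card S * (n div 2 ^ k + 1)"
    using T(2) by (rule mult_right_mono) simp
  finally show ?thesis .
qed

lemma conn_number_le:
  assumes "r \<ge> 1" "n \<ge> r"
  shows "real (conn_number n r s) \<le> 3 * (2 ^ s / real r) * real n"
proof -
  \<comment> \<open>With the largest power of two up to \<open>r\<close>, the colours are legal and
    \<open>2 ^ k > r / 2\<close> costs only a factor 2.\<close>
  obtain k where k: "2 ^ k \<le> r" "r < 2 ^ (k + 1)"
    using ex_power_ivl1[of 2 r] assms by auto
  have "xor_colouring k {u, v} < r" for u v
    using k(1) take_bit_nat_less_exp[of k "Bit_Operations.xor u v"] unfolding xor_colouring_pair
    by linarith
  then have "edge_colouring n r (xor_colouring k)"
    by (auto simp: edge_colouring_def)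
  moreover have "guaranteed n r s (conn_number n r s)"
    using le_conn_number_iff[of n r "conn_number n r s" s] assms by simp
  ultimately obtain S u where S: "S \<subseteq> {0..<r}" "card S \<le> s" and "u < n"
    and "conn_number n r s \<le> card (component n (xor_colouring k) S u)"
    unfolding guaranteed_iff_component by blast
  moreover have "finite S" using S finite_subset by blast
  ultimately have "conn_number n r s \<le> 2 ^ card S * (n div 2 ^ k + 1)"
    using card_component_xor_colouring le_trans by blast
  also have "\<dots> \<le> 2 ^ s * (n div 2 ^ k + 1)"
    using S(2) by (intro mult_right_mono power_increasing) auto
  finally have "real (conn_number n r s) \<le> real (2 ^ s * (n div 2 ^ k + 1))"
    using of_nat_le_iff by blast
  also have "\<dots> = 2 ^ s * (real (n div 2 ^ k) + 1)" by (simp add: distrib_left)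
  also have "\<dots> \<le> 2 ^ s * (3 * real n / real r)"
  proof (rule mult_left_mono)
    have "real (n div 2 ^ k) \<le> real n / 2 ^ k"
      using of_nat_div_le_of_nat[of n "2 ^ k"] by simp
    also have "\<dots> \<le> real n / (real r / 2)"
    proof (rule divide_left_mono)
      have "real r \<le> real (2 ^ (k + 1))" using k(2) by linarith
      then show "real r / 2 \<le> 2 ^ k" by simp
    qed (use assms in auto)
    finally have "real (n div 2 ^ k) \<le> 2 * real n / real r" by (simp add: mult.commute)
    \<comment> \<open>Since \<open>n \<ge> r\<close>, the rounding term 1 is absorbed, which raises
      the constant from 2 to 3.\<close>
    moreover have "1 \<le> real n / real r" using assms by simp
    ultimately have "real (n div 2 ^ k) + 1 \<le> 2 * real n / real r + real n / real r"
      by (rule add_mono)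
    then show "real (n div 2 ^ k) + 1 \<le> 3 * real n / real r"
      by (simp add: add_divide_distrib[symmetric])
  qed simp
  finally show ?thesis by (simp add: field_simps)
qed

section \<open>The lower bound\<close>

text \<open>A probability weight whose density against the uniform one is at most \<open>K\<close>;
  \<open>1 / g\<close> is a lower bound for the harmonic mean of the component size of a
  \<open>\<nu>\<close>-random vertex.\<close>

definition spread_weight ::
  "nat \<Rightarrow> (nat set \<Rightarrow> nat) \<Rightarrow> nat set \<Rightarrow> real \<Rightarrow> real \<Rightarrow> (nat \<Rightarrow> real) \<Rightarrow> bool" where
  "spread_weight n \<chi> S K g \<nu> \<longleftrightarrow>
     (\<forall>u<n. 0 \<le> \<nu> u \<and> \<nu> u \<le> K / real n) \<and> (\<Sum>u<n. \<nu> u) = 1 \<and>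
     (\<Sum>u<n. \<nu> u / real (card (component n \<chi> S u))) \<le> g"

lemma spread_weight_mono:
  assumes "spread_weight n \<chi> S K g \<nu>" "K \<le> K'" "g \<le> g'"
  shows "spread_weight n \<chi> S K' g' \<nu>"
  using assms unfolding spread_weight_def
  by (meson divide_right_mono of_nat_0_le_iff order_trans)

text \<open>If all components were smaller than \<open>1 / g\<close>, every reciprocal, and hence
  the mean, would exceed \<open>g\<close>.\<close>

lemma spread_weight_component:
  assumes "spread_weight n \<chi> S K g \<nu>" "g > 0"
  shows "\<exists>u<n. 1 / g \<le> real (card (component n \<chi> S u))"
proof (rule ccontr)
  assume neg: "\<not> ?thesis"
  have nonneg: "\<forall>u<n. 0 \<le> \<nu> u" and one: "(\<Sum>u<n. \<nu> u) = 1"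
    and g: "(\<Sum>u<n. \<nu> u / real (card (component n \<chi> S u))) \<le> g"
    using assms unfolding spread_weight_def by auto
  have *: "g < 1 / real (card (component n \<chi> S u))" if "u < n" for u
  proof -
    have "real (card (component n \<chi> S u)) < 1 / g" using neg that by force
    then show ?thesis using card_component_pos[OF that, of \<chi> S] assms(2) by (simp add: field_simps)
  qed
  \<comment> \<open>Strictness of the sum needs one vertex of positive weight.\<close>
  obtain v where v: "v < n" "\<nu> v > 0"
  proof -
    have "\<exists>v<n. \<nu> v \<noteq> 0" using one by (metis lessThan_iff sum.neutral zero_neq_one)
    then show ?thesis using nonneg that by (metis order_le_less)
  qed
  have "g = (\<Sum>u<n. \<nu> u * g)" by (simp add: sum_distrib_right[symmetric] one)
  also have "\<dots> < (\<Sum>u<n. \<nu> u * (1 / real (card (component n \<chi> S u))))"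
  proof (rule sum_strict_mono_ex1)
    show "\<forall>u\<in>{..<n}. \<nu> u * g \<le> \<nu> u * (1 / real (card (component n \<chi> S u)))"
      using nonneg * by (intro ballI mult_left_mono) (auto intro: less_imp_le)
    show "\<exists>u\<in>{..<n}. \<nu> u * g < \<nu> u * (1 / real (card (component n \<chi> S u)))"
      using v * by (intro bexI[of _ v] mult_strict_left_mono) auto
  qed simp
  finally show False using g by simp
qed

section \<open>The first colour\<close>

text \<open>Halving from single vertices would start at mean reciprocal 1 instead of about
  \<open>r / n\<close>, so the first colour is chosen differently: a colour with at least the
  average number of edges, and the law of a random end of such an edge. The degree of a vertex in
  that colour is at most its component size, which gives both bounds.\<close>

lemma spread_weight_base:
  assumes n: "n \<ge> 2" and r: "r \<ge> 1" and \<chi>: "edge_colouring n r \<chi>"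
    and M: "\<And>i u. i < r \<Longrightarrow> u < n \<Longrightarrow> real (card (component n \<chi> {i} u)) \<le> M"
  shows "\<exists>i<r. \<exists>\<nu>. spread_weight n \<chi> {i} (M * real r / (real n - 1)) (real r / (real n - 1)) \<nu>"
proof -
  define N where "N i u = {w. w < n \<and> w \<noteq> u \<and> \<chi> {u, w} = i}" for i u
  define d where "d i u = real (card (N i u))" for i u
  \<comment> \<open>Twice the number of edges of colour \<open>i\<close>, as both ends are
    counted.\<close>
  define e where "e i = (\<Sum>u<n. d i u)" for i
  have finN: "finite (N i u)" for i u by (simp add: N_def)
  have degree: "(\<Sum>i<r. d i u) = real n - 1" if u: "u < n" for u
  proof -
    have "(\<Sum>i<r. card (N i u)) = card (\<Union>i<r. N i u)"
      by (rule card_UN_disjoint[symmetric]) (use finN in \<open>auto simp: N_def\<close>)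
    also have "(\<Union>i<r. N i u) = {..<n} - {u}"
      using edge_colouringD[OF \<chi> u] by (auto simp: N_def)
    finally have "(\<Sum>i<r. card (N i u)) = n - 1" using u by simp
    then show ?thesis
      unfolding d_def using n by (metis Suc_1 Suc_leD of_nat_1 of_nat_diff of_nat_sum)
  qed
  have "(\<Sum>i<r. e i) = (\<Sum>u<n. \<Sum>i<r. d i u)"
    unfolding e_def by (rule sum.swap)
  also have "\<dots> = real n * (real n - 1)" using degree by simp
  finally have sum_e: "(\<Sum>i<r. e i) = real n * (real n - 1)" .
  have "\<exists>i<r. real n * (real n - 1) / real r \<le> e i"
  proof (rule ccontr)
    assume "\<not> ?thesis"
    then have "(\<Sum>i<r. e i) < (\<Sum>i<r. real n * (real n - 1) / real r)"
      using r by (intro sum_strict_mono) (auto simp: not_le lessThan_empty_iff)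
    with sum_e r show False by simp
  qed
  then obtain i where i: "i < r" "real n * (real n - 1) / real r \<le> e i" by blast
  have pos: "real n * (real n - 1) / real r > 0" using n r by simp
  with i have e_pos: "e i > 0" by linarith
  have d_le: "d i u \<le> real (card (component n \<chi> {i} u))" if "u < n" for u
    unfolding d_def of_nat_le_iff
    by (rule card_mono[OF finite_component[OF that]])
      (use that in \<open>auto simp: N_def intro: component_arc\<close>)
  define \<nu> where "\<nu> u = d i u / e i" for u
  have "0 \<le> \<nu> u \<and> \<nu> u \<le> (M * real r / (real n - 1)) / real n" if u: "u < n" for u
  proof
    show "0 \<le> \<nu> u" using e_pos by (simp add: \<nu>_def d_def)
    have "\<nu> u \<le> M / e i"
      unfolding \<nu>_def using d_le[OF u] M[OF i(1) u] e_pos by (intro divide_right_mono) auto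
    also have "\<dots> \<le> M / (real n * (real n - 1) / real r)"
      using M[OF i(1) u] i(2) pos by (intro frac_le) linarith+
    finally show "\<nu> u \<le> (M * real r / (real n - 1)) / real n"
      by (simp add: mult.commute)
  qed
  moreover have "(\<Sum>u<n. \<nu> u) = 1"
    unfolding \<nu>_def sum_divide_distrib[symmetric] using e_pos by (simp add: e_def)
  moreover have "(\<Sum>u<n. \<nu> u / real (card (component n \<chi> {i} u))) \<le> real r / (real n - 1)"
  proof -
    have "(\<Sum>u<n. \<nu> u / real (card (component n \<chi> {i} u))) \<le> (\<Sum>u<n. 1 / e i)"
    proof (rule sum_mono)
      fix u assume "u \<in> {..<n}"
      then have "d i u / real (card (component n \<chi> {i} u)) \<le> 1"
        using d_le card_component_pos by (simp add: divide_le_eq_1)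
      then have "d i u / real (card (component n \<chi> {i} u)) / e i \<le> 1 / e i"
        using e_pos by (intro divide_right_mono) auto
      then show "\<nu> u / real (card (component n \<chi> {i} u)) \<le> 1 / e i"
        by (simp add: \<nu>_def mult.commute)
    qed
    also have "\<dots> = real n / e i" by simp
    also have "\<dots> \<le> real n / (real n * (real n - 1) / real r)"
      using i(2) pos by (intro frac_le) auto
    also have "\<dots> = real r / (real n - 1)" using n by simp
    finally show ?thesis .
  qed
  ultimately show ?thesis using i(1) unfolding spread_weight_def by blast
qed

section \<open>Adding one colour\<close>

text \<open>The inequality of harmonic and arithmetic mean for \<open>1 / a\<close> and
  \<open>1 / b\<close>. With both reciprocals of mean at most \<open>g\<close>, the right side has
  mean at most \<open>g / 2\<close>.\<close>

lemma inverse_add_le: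
  assumes "a > 0" "b > (0::real)"
  shows "1 / (a + b) \<le> (1 / a + 1 / b) / 4"
proof -
  have "4 * (a * b) \<le> (a + b) * (a + b)"
    using zero_le_square[of "a - b"] by (simp add: algebra_simps)
  then show ?thesis using assms by (simp add: field_simps)
qed

text \<open>\<open>\<delta>\<close> bounds the probability that two random vertices share a
  component, \<open>\<eta>\<close> the mass given up on improbable colours. Conditioning on the
  remaining mass costs the factor \<open>1 / (1 - \<delta> - \<eta>)\<close>.\<close>

lemma spread_weight_step:
  assumes n: "n \<ge> 1" and r: "r \<ge> 1" and \<chi>: "edge_colouring n r \<chi>"
    and M: "\<And>i u. i < r \<Longrightarrow> u < n \<Longrightarrow> real (card (component n \<chi> (insert i S) u)) \<le> M"
    and \<nu>: "spread_weight n \<chi> S K g \<nu>" and K: "K \<ge> 0"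
    and \<delta>: "K * M / real n \<le> \<delta>" and \<eta>: "\<eta> > 0" "\<delta> + \<eta> < 1"
  shows "\<exists>i<r. \<exists>\<nu>'. spread_weight n \<chi> (insert i S)
    (K\<^sup>2 * (M * real r / real n) / \<eta>) (g / 2 / (1 - \<delta> - \<eta>)) \<nu>'"
proof -
  have \<nu>0: "0 \<le> \<nu> u" and \<nu>K: "\<nu> u \<le> K / real n" if "u < n" for u
    using \<nu> that unfolding spread_weight_def by auto
  have one: "(\<Sum>u<n. \<nu> u) = 1" and g: "(\<Sum>u<n. \<nu> u / real (card (component n \<chi> S u))) \<le> g"
    using \<nu> unfolding spread_weight_def by auto
  define c where "c u = real (card (component n \<chi> S u))" for u
  define c' where "c' i u = real (card (component n \<chi> (insert i S) u))" for i u
  have c_pos: "c u > 0" and c'_pos: "c' i u > 0" if "u < n" for u i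
    using card_component_pos[OF that] by (simp_all add: c_def c'_def)
  \<comment> \<open>The joint law of the pair, restricted to separated pairs of colour
    \<open>i\<close>. \<open>P i\<close> is the probability of this event, and \<open>G i\<close>
    the unnormalised mean of the new reciprocal on it.\<close>
  define q where
    "q i u w = (if w \<notin> component n \<chi> S u \<and> \<chi> {u, w} = i then \<nu> u * \<nu> w else 0)" for i u w
  define P where "P i = (\<Sum>u<n. \<Sum>w<n. q i u w)" for i
  define G where "G i = (\<Sum>u<n. (\<Sum>w<n. q i u w) / c' i u)" for i
  have q0: "0 \<le> q i u w" if "u < n" "w < n" for i u w
    using \<nu>0 that by (simp add: q_def)
  have G0: "0 \<le> G i" for i
    unfolding G_def using q0 by (intro sum_nonneg divide_nonneg_nonneg) (auto simp: c'_def)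
  have sum_q: "(\<Sum>i<r. q i u w) = (if w \<notin> component n \<chi> S u then \<nu> u * \<nu> w else 0)"
    if "u < n" "w < n" for u w
  proof (cases "w \<in> component n \<chi> S u")
    case False
    then have "\<chi> {u, w} < r" using edge_colouringD[OF \<chi> that] self_in_component by metis
    then show ?thesis using False by (simp add: q_def)
  qed (simp add: q_def)
  have mass: "(\<Sum>w\<in>component n \<chi> T u. \<nu> w) \<le> K * c'' / real n"
    if u: "u < n" and T: "real (card (component n \<chi> T u)) \<le> c''" for u T c''
  proof -
    have "(\<Sum>w\<in>component n \<chi> T u. \<nu> w) \<le> (\<Sum>w\<in>component n \<chi> T u. K / real n)"
      using \<nu>K component_subset[OF u] by (intro sum_mono) blast
    also have "\<dots> = (K / real n) * real (card (component n \<chi> T u))" by simp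
    also have "\<dots> \<le> (K / real n) * c''" using K T by (intro mult_left_mono) auto
    finally show ?thesis by simp
  qed
  have sum_P: "(\<Sum>i<r. P i) \<ge> 1 - \<delta>"
  proof -
    have "(\<Sum>i<r. P i) = (\<Sum>u<n. \<Sum>i<r. \<Sum>w<n. q i u w)"
      unfolding P_def by (rule sum.swap)
    also have "\<dots> = (\<Sum>u<n. \<Sum>w<n. \<Sum>i<r. q i u w)"
      by (rule sum.cong[OF refl sum.swap])
    also have "\<dots> = (\<Sum>u<n. \<Sum>w<n. if w \<notin> component n \<chi> S u then \<nu> u * \<nu> w else 0)"
      using sum_q by (intro sum.cong) auto
    also have "\<dots> \<ge> (\<Sum>u<n. \<nu> u * (1 - \<delta>))"
    proof (rule sum_mono)
      fix u assume "u \<in> {..<n}"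
      then have u: "u < n" by simp
      \<comment> \<open>\<open>M\<close> bounds components only after a colour is added; any colour
        will do, and 0 exists as \<open>r \<ge> 1\<close>.\<close>
      have "card (component n \<chi> S u) \<le> card (component n \<chi> (insert 0 S) u)"
        by (intro card_mono finite_component u component_mono) auto
      then have "c u \<le> M" using M[of 0 u] r u unfolding c_def by linarith
      then have "(\<Sum>w\<in>component n \<chi> S u. \<nu> w) \<le> \<delta>"
        using mass[OF u, of S M] \<delta> unfolding c_def by linarith
      moreover have "(\<Sum>w\<in>{..<n} - component n \<chi> S u. \<nu> w)
          = 1 - (\<Sum>w\<in>component n \<chi> S u. \<nu> w)"
        using component_subset[OF u] one by (simp add: sum_diff)
      ultimately have "\<nu> u * (1 - \<delta>) \<le> \<nu> u * (\<Sum>w\<in>{..<n} - component n \<chi> S u. \<nu> w)"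
        using \<nu>0[OF u] by (intro mult_left_mono) auto
      also have "\<dots> = (\<Sum>w<n. if w \<notin> component n \<chi> S u then \<nu> u * \<nu> w else 0)"
        by (simp add: sum_distrib_left sum.If_cases Diff_eq)
          (simp add: Collect_neg_eq)
      finally show "\<nu> u * (1 - \<delta>)
        \<le> (\<Sum>w<n. if w \<notin> component n \<chi> S u then \<nu> u * \<nu> w else 0)" .
    qed
    also have "(\<Sum>u<n. \<nu> u * (1 - \<delta>)) = 1 - \<delta>"
      by (simp add: sum_distrib_right[symmetric] one)
    finally show ?thesis .
  qed
  have sum_G: "(\<Sum>i<r. G i) \<le> g / 2"
  proof -
    have "(\<Sum>i<r. G i) = (\<Sum>i<r. \<Sum>u<n. \<Sum>w<n. q i u w / c' i u)"
      unfolding G_def by (simp add: sum_divide_distrib)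
    also have "\<dots> \<le> (\<Sum>i<r. \<Sum>u<n. \<Sum>w<n. q i u w * ((1 / c u + 1 / c w) / 4))"
    proof (intro sum_mono)
      fix i u w assume "i \<in> {..<r}" "u \<in> {..<n}" "w \<in> {..<n}"
      then have uw: "u < n" "w < n" by auto
      show "q i u w / c' i u \<le> q i u w * ((1 / c u + 1 / c w) / 4)"
      proof (cases "w \<notin> component n \<chi> S u \<and> \<chi> {u, w} = i")
        case True
        then have "c u + c w \<le> c' i u"
          using card_component_insert[OF uw, of \<chi> S] unfolding c_def c'_def by auto
        then have "1 / c' i u \<le> 1 / (c u + c w)"
          using c_pos uw by (intro divide_left_mono) (auto intro!: mult_pos_pos add_pos_pos c'_pos)
        also have "\<dots> \<le> (1 / c u + 1 / c w) / 4"
          using c_pos uw by (intro inverse_add_le) auto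
        finally have "q i u w * (1 / c' i u) \<le> q i u w * ((1 / c u + 1 / c w) / 4)"
          using q0[OF uw] by (rule mult_left_mono)
        then show ?thesis by simp
      qed (auto simp: q_def)
    qed
    also have "\<dots> = (\<Sum>u<n. \<Sum>i<r. \<Sum>w<n. q i u w * ((1 / c u + 1 / c w) / 4))"
      by (rule sum.swap)
    also have "\<dots> = (\<Sum>u<n. \<Sum>w<n. \<Sum>i<r. q i u w * ((1 / c u + 1 / c w) / 4))"
      by (rule sum.cong[OF refl sum.swap])
    also have "\<dots> = (\<Sum>u<n. \<Sum>w<n. (\<Sum>i<r. q i u w) * ((1 / c u + 1 / c w) / 4))"
      by (simp only: sum_distrib_right)
    \<comment> \<open>Readmitting the pairs inside one component only enlarges the sum, and the
      double sum then factors by independence.\<close>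
    also have "\<dots> \<le> (\<Sum>u<n. \<Sum>w<n. (\<nu> u * \<nu> w) * ((1 / c u + 1 / c w) / 4))"
    proof (intro sum_mono mult_right_mono)
      fix u w assume "u \<in> {..<n}" "w \<in> {..<n}"
      then show "(\<Sum>i<r. q i u w) \<le> \<nu> u * \<nu> w" "0 \<le> (1 / c u + 1 / c w) / 4"
        using sum_q \<nu>0 by (auto simp: c_def intro!: add_nonneg_nonneg)
    qed
    also have "\<dots> = (\<Sum>u<n. \<Sum>w<n. (\<nu> u / c u) * \<nu> w / 4 + \<nu> u * (\<nu> w / c w) / 4)"
      by (intro sum.cong refl) (simp add: field_simps)
    also have "\<dots> = (\<Sum>u<n. \<nu> u / c u) * (\<Sum>w<n. \<nu> w) / 4 + (\<Sum>u<n. \<nu> u) * (\<Sum>w<n. \<nu> w / c w) / 4"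
      by (simp only: sum.distrib sum_divide_distrib sum_product)
    also have "\<dots> = (\<Sum>u<n. \<nu> u / c u) / 2" by (simp add: one)
    also have "\<dots> \<le> g / 2" using g by (simp add: c_def)
    finally show ?thesis .
  qed
  \<comment> \<open>There are at most \<open>r\<close> colours below the threshold
    \<open>\<eta> / r\<close>, so together they carry mass at most \<open>\<eta>\<close>.\<close>
  define I where "I = {i. i < r \<and> \<eta> / real r \<le> P i}"
  have I: "I \<subseteq> {..<r}" "finite I" by (auto simp: I_def)
  have "(\<Sum>i\<in>{..<r} - I. P i) \<le> (\<Sum>i\<in>{..<r} - I. \<eta> / real r)"
    by (intro sum_mono) (auto simp: I_def)
  also have "\<dots> \<le> (\<Sum>i<r. \<eta> / real r)"
    using \<eta> by (intro sum_mono2) auto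
  also have "\<dots> = \<eta>" using r by simp
  finally have sum_I: "(\<Sum>i\<in>I. P i) \<ge> 1 - \<delta> - \<eta>"
    using sum_P I by (simp add: sum_diff)
  let ?g = "g / 2 / (1 - \<delta> - \<eta>)"
  have g0: "0 \<le> g / 2" using sum_G G0 sum_nonneg[of "{..<r}" G] by fastforce
  \<comment> \<open>Averaging: if every ratio \<open>G i / P i\<close> exceeded \<open>?g\<close>,
    the sum of \<open>G\<close> would exceed \<open>g / 2\<close>.\<close>
  have "\<exists>i\<in>I. G i \<le> P i * ?g"
  proof (rule ccontr)
    assume "\<not> ?thesis"
    then have less: "P i * ?g < G i" if "i \<in> I" for i using that by force
    have "I \<noteq> {}" using sum_I \<eta> by auto
    have "1 - \<delta> - \<eta> \<noteq> 0" using \<eta> by simp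
    then have "g / 2 = (1 - \<delta> - \<eta>) * ?g" 
      by (metis nonzero_mult_div_cancel_left times_divide_eq_right)
    also have "\<dots> \<le> (\<Sum>i\<in>I. P i) * ?g"
      using sum_I g0 \<eta> by (intro mult_right_mono) auto
    also have "\<dots> = (\<Sum>i\<in>I. P i * ?g)" by (rule sum_distrib_right)
    also have "\<dots> < (\<Sum>i\<in>I. G i)"
      using less I \<open>I \<noteq> {}\<close> by (intro sum_strict_mono) auto
    also have "\<dots> \<le> (\<Sum>i<r. G i)" using I G0 by (intro sum_mono2) auto
    finally show False using sum_G by simp
  qed
  then obtain i where i: "i \<in> I" "G i \<le> P i * ?g" by blast
  have "i < r" and P_ge: "\<eta> / real r \<le> P i" using i(1) by (auto simp: I_def)
  have "\<eta> / real r > 0" using \<eta> r by simp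
  with P_ge have P_pos: "P i > 0" by linarith
  define \<nu>' where "\<nu>' u = (\<Sum>w<n. q i u w) / P i" for u
  have "0 \<le> \<nu>' u \<and> \<nu>' u \<le> (K\<^sup>2 * (M * real r / real n) / \<eta>) / real n" if u: "u < n" for u
  proof
    show "0 \<le> \<nu>' u"
      unfolding \<nu>'_def using q0 u P_pos by (intro divide_nonneg_pos sum_nonneg) auto
    \<comment> \<open>Only neighbours of \<open>u\<close> in colour \<open>i\<close> contribute.
      They lie in its enlarged component, which has mass at most \<open>K * M / n\<close>; this
      gains the factor of order \<open>1 / r\<close> that offsets the division by
      \<open>P i\<close>.\<close>
    have "(\<Sum>w<n. q i u w) \<le> (\<Sum>w<n. if w \<in> component n \<chi> (insert i S) u then \<nu> u * \<nu> w else 0)"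
    proof (rule sum_mono)
      fix w assume "w \<in> {..<n}"
      then show "q i u w \<le> (if w \<in> component n \<chi> (insert i S) u then \<nu> u * \<nu> w else 0)"
        using component_arc[of u n w \<chi> "insert i S"] u \<nu>0
        by (cases "u = w") (auto simp: q_def)
    qed
    also have "\<dots> = (\<Sum>w\<in>component n \<chi> (insert i S) u. \<nu> u * \<nu> w)"
      using component_subset[OF u, of \<chi> "insert i S"]
      by (simp add: sum.If_cases Int_absorb1)
    also have "\<dots> = \<nu> u * (\<Sum>w\<in>component n \<chi> (insert i S) u. \<nu> w)"
      by (simp add: sum_distrib_left)
    also have "\<dots> \<le> (K / real n) * (K * M / real n)"
      using \<nu>0[OF u] \<nu>K[OF u] mass[OF u M[OF \<open>i < r\<close> u]] K
      by (intro mult_mono) (auto intro!: sum_nonneg \<nu>0 dest: subsetD[OF component_subset[OF u]])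
    finally have *: "(\<Sum>w<n. q i u w) \<le> (K / real n) * (K * M / real n)" .
    have "M \<ge> 0" using M[OF \<open>i < r\<close> u] by linarith
    have "\<nu>' u \<le> (K / real n) * (K * M / real n) / P i"
      unfolding \<nu>'_def using * P_pos by (intro divide_right_mono) auto
    also have "\<dots> \<le> (K / real n) * (K * M / real n) / (\<eta> / real r)"
      using P_ge P_pos \<eta> r K \<open>M \<ge> 0\<close> by (intro divide_left_mono) auto
    also have "\<dots> = (K\<^sup>2 * (M * real r / real n) / \<eta>) / real n"
      by (simp add: power2_eq_square mult_ac)
    finally show "\<nu>' u \<le> (K\<^sup>2 * (M * real r / real n) / \<eta>) / real n" .
  qed
  moreover have "(\<Sum>u<n. \<nu>' u) = 1"
    unfolding \<nu>'_def sum_divide_distrib[symmetric] using P_pos by (simp add: P_def)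
  moreover have "(\<Sum>u<n. \<nu>' u / real (card (component n \<chi> (insert i S) u))) \<le> ?g"
  proof -
    have "(\<Sum>u<n. \<nu>' u / real (card (component n \<chi> (insert i S) u))) = G i / P i"
      unfolding \<nu>'_def G_def c'_def sum_divide_distrib by (intro sum.cong) (auto simp: mult.commute)
    also have "\<dots> \<le> ?g" using i(2) P_pos by (simp add: divide_le_eq mult.commute)
    finally show ?thesis .
  qed
  ultimately show ?thesis using \<open>i < r\<close> unfolding spread_weight_def by blast
qed

section \<open>Iteration over the colours and the constants\<close>

text \<open>The recursion is that of \<open>spread_weight_step\<close> with \<open>M = 2 ^ s n / r\<close> and \<open>\<eta> = 1 / (4 s)\<close>.\<close>

fun spread_const :: "nat \<Rightarrow> nat \<Rightarrow> real" where
  "spread_const s 0 = 2 ^ (s + 1)"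
| "spread_const s (Suc t) = (spread_const s t)\<^sup>2 * 2 ^ s * (4 * real s)"

lemma spread_const_nonneg: "0 \<le> spread_const s t"
  by (induction t) auto

text \<open>One colour for the base and one for each of \<open>t\<close> halvings. The assumption
  \<open>large\<close> says that \<open>\<delta> = 1 / (4 * s)\<close> is admissible at each
  step.\<close>

lemma spread_weight_exists:
  fixes n r s :: nat
  assumes n: "n \<ge> 2" and r: "r \<ge> 1" and s: "s \<ge> 1" and \<chi>: "edge_colouring n r \<chi>"
    and M: "\<And>S u. S \<subseteq> {0..<r} \<Longrightarrow> card S \<le> s \<Longrightarrow> u < n \<Longrightarrow>
      real (card (component n \<chi> S u)) \<le> 2 ^ s * real n / real r"
    and large: "\<And>t. t < s \<Longrightarrow> spread_const s t * 2 ^ s * (4 * real s) \<le> real r"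
    and t: "t < s"
  shows "\<exists>S\<subseteq>{0..<r}. card S \<le> Suc t \<and> (\<exists>\<nu>. spread_weight n \<chi> S (spread_const s t)
    (real r / (real n - 1) * ((1 + 1 / real s) / 2) ^ t) \<nu>)"
  using t
proof (induction t)
  case 0
  have "\<exists>i<r. \<exists>\<nu>. spread_weight n \<chi> {i}
    (2 ^ s * real n / real r * real r / (real n - 1)) (real r / (real n - 1)) \<nu>"
    by (rule spread_weight_base[OF n r \<chi>]) (rule M, use s in auto)
  then obtain i \<nu> where "i < r" and \<nu>: "spread_weight n \<chi> {i}
    (2 ^ s * real n / real r * real r / (real n - 1)) (real r / (real n - 1)) \<nu>" by blast
  \<comment> \<open>This factor 2 explains the exponent \<open>s + 1\<close> in
    \<open>spread_const s 0\<close>.\<close>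
  have "real n / (real n - 1) \<le> 2" using n by (simp add: field_simps)
  then have "2 ^ s * (real n / (real n - 1)) \<le> 2 ^ s * 2" by (intro mult_left_mono) auto
  then have "2 ^ s * real n / real r * real r / (real n - 1) \<le> spread_const s 0"
    using r by (simp add: mult.commute)
  with \<nu> have "spread_weight n \<chi> {i} (spread_const s 0)
      (real r / (real n - 1) * ((1 + 1 / real s) / 2) ^ 0) \<nu>"
    by (rule spread_weight_mono) simp
  with \<open>i < r\<close> show ?case by (intro exI[of _ "{i}"]) auto
next
  case (Suc t)
  let ?K = "spread_const s t" and ?g = "real r / (real n - 1) * ((1 + 1 / real s) / 2) ^ t"
  let ?M = "2 ^ s * real n / real r" and ?d = "1 / (4 * real s)"
  from Suc obtain S \<nu> where S: "S \<subseteq> {0..<r}" "card S \<le> Suc t"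
    and \<nu>: "spread_weight n \<chi> S ?K ?g \<nu>" by auto
  have fin: "finite S" using S finite_subset by blast
  have card: "card (insert i S) \<le> Suc (Suc t)" for i
    using S(2) card_insert_le_m1[of "Suc (Suc t)" S i] by simp
  have "?K * ?M / real n = ?K * 2 ^ s / real r" using n by simp
  also have "\<dots> \<le> ?d" using large[of t] Suc.prems s r by (simp add: field_simps)
  finally have \<delta>: "?K * ?M / real n \<le> ?d" .
  have "\<exists>i<r. \<exists>\<nu>'. spread_weight n \<chi> (insert i S)
      (?K\<^sup>2 * (?M * real r / real n) / ?d) (?g / 2 / (1 - ?d - ?d)) \<nu>'"
  proof (rule spread_weight_step[OF _ r \<chi> _ \<nu> spread_const_nonneg \<delta>])
    fix i u assume "i < r" "u < n"
    then show "real (card (component n \<chi> (insert i S) u)) \<le> ?M"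
      using M[of "insert i S" u] S(1) card[of i] Suc.prems by auto
  qed (use n s in \<open>auto simp: field_simps\<close>)
  then obtain i \<nu>' where "i < r" and \<nu>': "spread_weight n \<chi> (insert i S)
      (?K\<^sup>2 * (?M * real r / real n) / ?d) (?g / 2 / (1 - ?d - ?d)) \<nu>'" by blast
  have "?K\<^sup>2 * (?M * real r / real n) / ?d = spread_const s (Suc t)"
    using n r by simp
  moreover have "?g / 2 / (1 - ?d - ?d) \<le> real r / (real n - 1) * ((1 + 1 / real s) / 2) ^ Suc t"
  proof -
    \<comment> \<open>Here \<open>1 - ?d - ?d = 1 - 1 / (2 * s)\<close>, and its product with
      \<open>1 + 1 / s\<close> is at least 1 for \<open>s \<ge> 1\<close>.\<close>
    have "1 / (1 - ?d - ?d) \<le> 1 + 1 / real s"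
      using s by (simp add: field_simps)
    then have "?g / 2 * (1 / (1 - ?d - ?d)) \<le> ?g / 2 * (1 + 1 / real s)"
      using n by (intro mult_left_mono) auto
    then show ?thesis by (simp add: mult_ac)
  qed
  ultimately have "spread_weight n \<chi> (insert i S) (spread_const s (Suc t))
      (real r / (real n - 1) * ((1 + 1 / real s) / 2) ^ Suc t) \<nu>'"
    using spread_weight_mono[OF \<nu>'] by simp
  with \<open>i < r\<close> S(1) card show ?case by (intro exI[of _ "insert i S"]) auto
qed

text \<open>The constant 12 is 3 for the accumulated losses, 2 for having only \<open>s - 1\<close>
  halvings, and 2 for \<open>n - 1 \<ge> n / 2\<close>.\<close>

lemma le_conn_number:
  fixes n r s :: nat
  assumes s: "s \<ge> 1" and r: "r \<ge> 1" and n: "n \<ge> 2"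
    and large: "\<And>t. t < s \<Longrightarrow> spread_const s t * 2 ^ s * (4 * real s) \<le> real r"
  shows "1 / 12 * (2 ^ s / real r) * real n \<le> real (conn_number n r s)"
proof (cases "2 ^ s * real n / real r \<le> real (conn_number n r s)")
  case True
  have "1 / 12 * (2 ^ s / real r) * real n = 1 / 12 * (2 ^ s * real n / real r)" by simp
  also have "\<dots> \<le> 1 * (2 ^ s * real n / real r)" by (rule mult_right_mono) auto
  finally show ?thesis using True by linarith
next
  case False
  \<comment> \<open>Maximality yields a colouring in which \<open>s\<close> colours never connect
    more than \<open>conn_number n r s\<close> vertices, which is below \<open>2 ^ s * n / r\<close>
    in this case. This supplies the bound \<open>M\<close>.\<close>
  have "\<not> guaranteed n r s (conn_number n r s + 1)"
    using le_conn_number_iff[of n r "conn_number n r s + 1" s] r n by simp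
  then obtain \<chi> where \<chi>: "edge_colouring n r \<chi>"
    and small: "\<And>S u. S \<subseteq> {0..<r} \<Longrightarrow> card S \<le> s \<Longrightarrow> u < n \<Longrightarrow>
      card (component n \<chi> S u) \<le> conn_number n r s"
    unfolding guaranteed_iff_component Suc_eq_plus1[symmetric] not_less_eq_eq[symmetric] by blast
  have M: "real (card (component n \<chi> S u)) \<le> 2 ^ s * real n / real r"
    if "S \<subseteq> {0..<r}" "card S \<le> s" "u < n" for S u
    using small[OF that] False by linarith
  let ?g = "real r / (real n - 1) * ((1 + 1 / real s) / 2) ^ (s - 1)"
  obtain S \<nu> where S: "S \<subseteq> {0..<r}" "card S \<le> s"
    and \<nu>: "spread_weight n \<chi> S (spread_const s (s - 1)) ?g \<nu>"
    using spread_weight_exists[OF n r s \<chi> M large, of "s - 1"] s by auto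
  have g_pos: "?g > 0" using n r by (intro mult_pos_pos zero_less_power divide_pos_pos add_pos_nonneg) auto
  obtain u where u: "u < n" "1 / ?g \<le> real (card (component n \<chi> S u))"
    using spread_weight_component[OF \<nu> g_pos] by blast
  have "(1 + 1 / real s) ^ (s - 1) \<le> (1 + 1 / real s) ^ s"
    by (intro power_increasing) auto
  also have "\<dots> \<le> exp (1 / real s) ^ s"
    by (intro power_mono) auto
  also have "\<dots> = exp 1" using s by (simp add: exp_of_nat_mult[symmetric])
  also have "\<dots> \<le> 3" by (rule exp_le)
  finally have "(1 + 1 / real s) ^ (s - 1) \<le> 3" .
  moreover have "(2::real) ^ s = 2 * 2 ^ (s - 1)" using s by (simp add: power_eq_if)
  ultimately have "((1 + 1 / real s) / 2) ^ (s - 1) \<le> 6 / 2 ^ s"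
    by (simp add: power_divide divide_right_mono)
  moreover have "real r / (real n - 1) \<le> real r / (real n / 2)"
    using n by (intro divide_left_mono) auto
  ultimately have "?g \<le> real r / (real n / 2) * (6 / 2 ^ s)"
    by (intro mult_mono) auto
  then have "1 / (real r / (real n / 2) * (6 / 2 ^ s)) \<le> 1 / ?g"
    using g_pos by (intro frac_le) auto
  also have "\<dots> \<le> real (conn_number n r s)"
    using u small[OF S u(1)] by linarith
  finally show ?thesis by (simp add: field_simps)
qed

section \<open>The two bounds combined\<close>

theorem theorem1p1:
  shows "\<exists>c C C\<^sub>0 :: real. c > 0 \<and> C > 0 \<and> C\<^sub>0 > 0 \<and>
    (\<forall>s :: nat. s \<ge> 1 \<longrightarrow> (\<exists>r\<^sub>0 :: nat. \<forall>r n :: nat. r \<ge> r\<^sub>0 \<and> real n \<ge> C\<^sub>0 * real r \<longrightarrow>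
       c * (2 ^ s / real r) * real n \<le> real (conn_number n r s) \<and>
       real (conn_number n r s) \<le> C * (2 ^ s / real r) * real n))"
proof -
  have main: "\<exists>r\<^sub>0 :: nat. \<forall>r n :: nat. r \<ge> r\<^sub>0 \<and> real n \<ge> 2 * real r \<longrightarrow>
       1 / 12 * (2 ^ s / real r) * real n \<le> real (conn_number n r s) \<and>
       real (conn_number n r s) \<le> 3 * (2 ^ s / real r) * real n" if s: "s \<ge> 1" for s :: nat
  proof -
    \<comment> \<open>A sum of nonnegative thresholds dominates each of them.\<close>
    define B where "B = (\<Sum>t<s. spread_const s t * 2 ^ s * (4 * real s))"
    have B: "spread_const s t * 2 ^ s * (4 * real s) \<le> B" if "t < s" for t
      unfolding B_def using that spread_const_nonneg by (intro member_le_sum) auto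
    \<comment> \<open>The summand 1 ensures \<open>r \<ge> 1\<close>; then
      \<open>n \<ge> 2 * r\<close> gives both \<open>n \<ge> 2\<close> and
      \<open>n \<ge> r\<close>.\<close>
    show ?thesis
    proof (intro exI[of _ "nat \<lceil>B\<rceil> + 1"] allI impI conjI)
      fix r n :: nat
      assume *: "r \<ge> nat \<lceil>B\<rceil> + 1 \<and> real n \<ge> 2 * real r"
      then have r: "r \<ge> 1" "B \<le> real r" and n: "n \<ge> 2 * r" by linarith+
      show "1 / 12 * (2 ^ s / real r) * real n \<le> real (conn_number n r s)"
        using le_conn_number[OF s r(1), of n] B r n by fastforce
      show "real (conn_number n r s) \<le> 3 * (2 ^ s / real r) * real n"
        using conn_number_le r n by simp
    qed
  qed
  show ?thesis
    by (rule exI[of _ "1 / 12"], rule exI[of _ 3], rule exI[of _ 2]) (use main in auto)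
qed

end
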